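(* Let $n\ge 0$ be an integer and let $x$ be a positive integer. Then $L_n = 3x^2$ if and only if $(n,x)=(2,1)$. That is, the only Lucas number of the form $3x^2$ with $x$ a positive integer is $L_2 = 3\cdot 1^2$.
   Context: The Lucas sequence $(L_n)_{n\ge 0}$ is defined by $L_0=2$, $L_1=1$, and $L_{n+2}=L_{n+1}+L_n$ for all $n\ge 0$. *)

theory Defs
  imports "HOL-Number_Theory.Number_Theory"
begin

fun lucas_num :: "nat \<Rightarrow> nat"
  where
    "lucas_num 0 = 2"
  | "lucas_num (Suc 0) = 1"
  | "lucas_num (Suc (Suc n)) = lucas_num (Suc n) + lucas_num n"

end

theory Submission
  imports Defs
begin

text \<open>
  For even \<open>k\<close> we have \<open>L(m + 2k) \<equiv> - L(m)\<close> modulo \<open>L(k)\<close>. If \<open>L(n) = 3x\<^sup>2\<close> then \<open>3\<close> divides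
  \<open>L(n)\<close>, so \<open>n \<equiv> \<plusminus>2\<close> modulo \<open>8\<close>. For \<open>n \<noteq> 2\<close> this gives \<open>n = \<plusminus>2 + 2gk\<close> with \<open>g\<close> odd and
  \<open>k = 2^s\<close>, \<open>s \<ge> 2\<close>, whence \<open>3x\<^sup>2 \<equiv> - L(2) = -3\<close> modulo \<open>L(k)\<close>. Since \<open>L(k)\<close> is coprime to
  \<open>3\<close> and congruent to \<open>3\<close> modulo \<open>4\<close>, it cannot divide \<open>x\<^sup>2 + 1\<close>.
\<close>

section \<open>Odd divisors of \<open>x\<^sup>2 + 1\<close>\<close>

lemma prime_dvd_square_plus_one_mod_4:
  fixes p x :: nat
  assumes "prime p" "p dvd x\<^sup>2 + 1"
  shows "p mod 4 \<noteq> 3"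
proof
  assume p3: "p mod 4 = 3"
  define k where "k = p div 4"
  \<comment> \<open>Half of \<open>p - 1\<close> is odd, so raising \<open>x\<^sup>2 = -1\<close> to
    that power gives \<open>-1\<close>, against the value \<open>1\<close> from Fermat's
    theorem.\<close>
  have p: "p - 1 = 2 * (2 * k + 1)"
    using p3 unfolding k_def by presburger
  have "\<not> p dvd x"
  proof
    assume "p dvd x"
    then have "p dvd x\<^sup>2"
      by (simp add: power2_eq_square)
    then have "p dvd 1"
      using assms(2) dvd_add_right_iff by blast
    then show False
      using assms(1) by auto
  qed
  then have "[x ^ (p - 1) = 1] (mod p)"
    using assms(1) fermat_theorem by blast
  then have "[int x ^ (p - 1) = 1] (mod int p)"
    by (metis cong_int_iff of_nat_1 of_nat_power)
  moreover have "[int x ^ (p - 1) = - 1] (mod int p)"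
  proof -
    have "int p dvd int (x\<^sup>2 + 1)"
      using assms(2) by (simp only: of_nat_dvd_iff)
    then have "[(int x)\<^sup>2 = - 1] (mod int p)"
      by (simp add: cong_iff_dvd_diff add.commute)
    then have "[((int x)\<^sup>2) ^ (2 * k + 1) = (- 1) ^ (2 * k + 1)] (mod int p)"
      by (rule cong_pow)
    then show ?thesis
      unfolding p power_mult by simp
  qed
  ultimately have "[1 = - 1] (mod int p)"
    using cong_sym cong_trans by blast
  then have "int p dvd 2"
    by (simp add: cong_iff_dvd_diff)
  then have "p \<le> 2"
    using zdvd_imp_le by fastforce
  with p3 show False
    by simp
qed

text \<open>Split off a prime factor: it is odd and not 3 modulo 4, and the cofactor is 1 modulo 4
  by induction.\<close>

lemma odd_dvd_square_plus_one_mod_4: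
  fixes N x :: nat
  assumes "odd N" "N dvd x\<^sup>2 + 1"
  shows "N mod 4 = 1"
  using assms
proof (induction N rule: less_induct)
  case (less N)
  show ?case
  proof (cases "N = 1")
    case False
    then obtain p where p: "prime p" "p dvd N"
      using prime_factor_nat by blast
    then obtain M where M: "N = p * M"
      by blast
    have "p > 1" "M > 0"
      using p(1) prime_gt_1_nat less.prems(1) M by (auto intro: Nat.gr0I)
    then have "M < N"
      unfolding M by simp
    have "M mod 4 = 1"
      using less.IH[OF \<open>M < N\<close>] less.prems M dvd_mult_right by auto
    moreover have "p mod 4 = 1"
    proof -
      have "p mod 4 \<noteq> 3"
        using prime_dvd_square_plus_one_mod_4 p less.prems(2) dvd_trans by blast
      moreover have "odd p"
        using less.prems(1) M by simp
      ultimately show ?thesis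
        by presburger
    qed
    ultimately show ?thesis
      unfolding M by (subst mod_mult_eq [symmetric]) simp
  qed simp
qed

section \<open>Lucas identities and shifts of the index\<close>

lemma lucas_cassini:
  "int (lucas_num a) * int (lucas_num (a + 2)) = (int (lucas_num (Suc a)))\<^sup>2 + 5 * (- 1) ^ a"
  by (induction a) (auto simp: algebra_simps power2_eq_square numeral_eq_Suc)

text \<open>Both formulas go through one induction, since the recurrence mixes even and odd indices;
  \<open>lucas_cassini\<close> removes the term with index \<open>a + 2\<close>.\<close>

lemma lucas_double:
  "int (lucas_num (2 * a)) = (int (lucas_num a))\<^sup>2 - 2 * (- 1) ^ a \<and>
   int (lucas_num (2 * a + 1)) = int (lucas_num a) * int (lucas_num (a + 1)) - (- 1) ^ a"
proof (induction a)
  case (Suc a)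
  have *: "int (lucas_num (2 * Suc a)) = (int (lucas_num (Suc a)))\<^sup>2 - 2 * (- 1) ^ Suc a"
    using Suc.IH lucas_cassini[of a] by (simp add: algebra_simps power2_eq_square)
  then show ?case
    using Suc.IH by (simp add: algebra_simps power2_eq_square)
qed simp

text \<open>Both sides satisfy the Lucas recurrence in \<open>m\<close>, and the cases
  \<open>m = 0\<close> and \<open>m = 1\<close> are the doubling formulas.\<close>

lemma lucas_shift:
  "int (lucas_num (m + 2 * a)) + (- 1) ^ a * int (lucas_num m) =
   int (lucas_num a) * int (lucas_num (m + a))"
proof (induction m rule: lucas_num.induct)
  case 1
  then show ?case
    using lucas_double[of a] by (simp add: power2_eq_square)
next
  case 2
  then show ?case
    using lucas_double[of a] by simp
next
  case (3 m)
  then show ?case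
    by (simp add: algebra_simps)
qed

lemma lucas_shift_even:
  assumes "even a"
  shows "lucas_num (m + 2 * a) + lucas_num m = lucas_num a * lucas_num (m + a)"
proof -
  have "int (lucas_num (m + 2 * a) + lucas_num m) = int (lucas_num a * lucas_num (m + a))"
    using lucas_shift[of m a] assms by simp
  then show ?thesis
    by (simp only: of_nat_eq_iff)
qed

lemma lucas_dvd_shift:
  assumes "even a"
  shows "lucas_num a dvd lucas_num (m + 2 * a) + lucas_num m"
  using lucas_shift_even[OF assms] by simp

text \<open>A shift by \<open>2 * k\<close> changes the sign modulo \<open>lucas_num k\<close>, so
  two of them restore the residue.\<close>

lemma lucas_dvd_period:
  assumes "even k" "lucas_num k dvd lucas_num m + c"
  shows "lucas_num k dvd lucas_num (m + 4 * k * h) + c"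
proof (induction h)
  case (Suc h)
  let ?r = "m + 4 * k * h"
  have "lucas_num k dvd lucas_num (?r + 2 * k + 2 * k) + lucas_num (?r + 2 * k)"
    "lucas_num k dvd lucas_num (?r + 2 * k) + lucas_num ?r"
    using lucas_dvd_shift[OF assms(1)] by blast+
  then have "lucas_num k dvd
      (lucas_num (?r + 2 * k + 2 * k) + lucas_num (?r + 2 * k)) + (lucas_num ?r + c)"
    using Suc.IH by simp
  \<comment> \<open>Regrouping isolates a known multiple that can be cancelled without subtraction
    on \<open>nat\<close>.\<close>
  then have "lucas_num k dvd
      (lucas_num (?r + 2 * k) + lucas_num ?r) + (lucas_num (?r + 2 * k + 2 * k) + c)"
    by (simp only: ac_simps)
  then have "lucas_num k dvd lucas_num (?r + 2 * k + 2 * k) + c"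
    using \<open>lucas_num k dvd lucas_num (?r + 2 * k) + lucas_num ?r\<close> dvd_add_right_iff by blast
  then show ?case
    by (simp add: algebra_simps)
qed (use assms in simp)

section \<open>Residues of Lucas numbers\<close>

lemma lucas_num_small:
  "lucas_num 1 = 1" "lucas_num 2 = 3" "lucas_num 3 = 4" "lucas_num 4 = 7"
  by (simp_all add: numeral_eq_Suc)

lemma three_dvd_lucas_imp:
  "3 dvd lucas_num n \<Longrightarrow> n mod 4 = 2"
proof (induction n rule: less_induct)
  case (less n)
  show ?case
  proof (cases "n < 4")
    case True
    then consider "n = 0" | "n = 1" | "n = 2" | "n = 3"
      by linarith
    then show ?thesis
      using less.prems by cases (simp_all add: lucas_num_small)
  next
    case False
    then obtain m where m: "n = m + 4"
      by (metis add.commute le_add_diff_inverse not_less)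
    have "lucas_num n = 3 * lucas_num (Suc m) + 2 * lucas_num m"
      unfolding m by (simp add: numeral_eq_Suc)
    then have "3 dvd lucas_num m"
      using less.prems by presburger
    then show ?thesis
      using less.IH[of m] m by simp
  qed
qed

text \<open>The modulus 12 captures the residues modulo 3 and 4 together. Since 7 and 11 both square
  to 1, doubling the index always yields -1, that is 11.\<close>

lemma lucas_power_of_two_mod_12:
  "lucas_num (4 * 2 ^ t) mod 12 = 7 \<or> lucas_num (4 * 2 ^ t) mod 12 = 11"
proof (induction t)
  case 0
  show ?case
    by (simp add: lucas_num_small)
next
  case (Suc t)
  let ?k = "4 * 2 ^ t :: nat"
  have "int (lucas_num (2 * ?k)) = (int (lucas_num ?k))\<^sup>2 - 2"
    using lucas_double[of ?k] by simp
  then have "int (lucas_num (2 * ?k)) mod 12 = ((int (lucas_num ?k) mod 12)\<^sup>2 - 2) mod 12"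
    by (metis mod_diff_left_eq power_mod)
  moreover have "int (lucas_num ?k) mod 12 = int (lucas_num ?k mod 12)"
    by (simp only: of_nat_mod of_nat_numeral)
  ultimately have "int (lucas_num (2 * ?k)) mod 12 = 11"
    using Suc.IH by (elim disjE) simp_all
  then have "int (lucas_num (2 * ?k) mod 12) = int 11"
    by (simp only: of_nat_mod of_nat_numeral)
  then have "lucas_num (2 * ?k) mod 12 = 11"
    by (simp only: of_nat_eq_iff)
  then show ?case
    by (simp add: mult.left_commute)
qed

section \<open>Choice of the modulus and conclusion\<close>

lemma power_of_two_times_odd:
  fixes q :: nat
  assumes "q > 0"
  obtains t h where "q = 2 ^ t * (2 * h + 1)"
proof -
  obtain r where "q = 2 ^ multiplicity 2 q * r" "odd r"
    using assms by (rule_tac multiplicity_decompose'[of q 2]) auto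
  then show thesis
    using that by (metis oddE)
qed

lemma lucas_dvd_plus_three:
  assumes "n mod 4 = 2" "n \<noteq> 2"
  obtains t where "lucas_num (4 * 2 ^ t) dvd lucas_num n + 3"
proof -
  note L2 = lucas_num_small(2)
  consider q where "n = 2 + 8 * q" "q > 0" | q where "n + 2 = 8 * q" "q > 0"
  proof (cases "n mod 8 = 2")
    case True
    with assms(2) have "n = 2 + 8 * (n div 8)" "n div 8 > 0"
      by presburger+
    then show thesis using that(1) by blast
  next
    case False
    with assms(1) have "n + 2 = 8 * ((n + 2) div 8)" "(n + 2) div 8 > 0"
      by presburger+
    then show thesis using that(2) by blast
  qed
  then show thesis
  proof cases
    case 1
    obtain t h where q: "q = 2 ^ t * (2 * h + 1)"
      using power_of_two_times_odd 1(2) by blast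
    \<comment> \<open>With this \<open>?k\<close>, \<open>8 * q\<close> equals
      \<open>2 * ?k + 4 * ?k * h\<close>: one sign change followed by \<open>h\<close> full
      periods.\<close>
    let ?k = "4 * 2 ^ t :: nat"
    have "lucas_num ?k dvd lucas_num (2 + 2 * ?k) + 3"
      using lucas_dvd_shift[of ?k 2] L2 by simp
    then have "lucas_num ?k dvd lucas_num (2 + 2 * ?k + 4 * ?k * h) + 3"
      by (intro lucas_dvd_period) auto
    moreover have "2 + 2 * ?k + 4 * ?k * h = n"
      unfolding 1(1) q by (simp add: algebra_simps)
    ultimately show thesis
      using that by metis
  next
    case 2
    obtain t h where q: "q = 2 ^ t * (2 * h + 1)"
      using power_of_two_times_odd 2(2) by blast
    let ?k = "4 * 2 ^ t :: nat"
    have k: "?k \<ge> 4"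
      by simp
    have "lucas_num ?k dvd lucas_num (2 * ?k - 2) + 3"
    proof -
      \<comment> \<open>Shifting from 2 by \<open>2 * ?a\<close> reaches \<open>2 * ?k - 2\<close>,
        and the middle index \<open>2 + ?a\<close> is exactly \<open>?k\<close>.\<close>
      let ?a = "?k - 2"
      have "lucas_num (2 + 2 * ?a) + lucas_num 2 = lucas_num ?a * lucas_num (2 + ?a)"
        by (rule lucas_shift_even) simp
      moreover have "2 + 2 * ?a = 2 * ?k - 2" "2 + ?a = ?k"
        using k by linarith+
      ultimately show ?thesis
        by (metis L2 dvd_triv_right)
    qed
    then have "lucas_num ?k dvd lucas_num (2 * ?k - 2 + 4 * ?k * h) + 3"
      by (intro lucas_dvd_period) auto
    moreover have "2 * ?k - 2 + 4 * ?k * h = n"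
    proof -
      have "n + 2 = 2 * ?k + 4 * ?k * h"
        unfolding 2(1) q by (simp add: algebra_simps)
      then show ?thesis
        using k by linarith
    qed
    ultimately show thesis
      using that by metis
  qed
qed

theorem lemma3p2:
  fixes n x :: nat
  assumes "x > 0"
  shows "lucas_num n = 3 * x\<^sup>2 \<longleftrightarrow> (n, x) = (2, 1)"
proof
  assume L: "lucas_num n = 3 * x\<^sup>2"
  have "n = 2"
  proof (rule ccontr)
    assume "n \<noteq> 2"
    moreover have "n mod 4 = 2"
      using three_dvd_lucas_imp L by simp
    ultimately obtain t where t: "lucas_num (4 * 2 ^ t) dvd lucas_num n + 3"
      using lucas_dvd_plus_three by blast
    let ?N = "lucas_num (4 * 2 ^ t)"
    have "m mod 4 = 3 \<and> odd m \<and> \<not> 3 dvd m" if "m mod 12 = 7 \<or> m mod 12 = 11" for m :: nat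
      using that by presburger
    then have N: "?N mod 4 = 3" "odd ?N" "\<not> 3 dvd ?N"
      using lucas_power_of_two_mod_12 by blast+
    then have "coprime ?N 3"
      using prime_imp_coprime_nat[of 3 ?N] by (simp add: coprime_commute)
    \<comment> \<open>This is \<open>lucas_num n + 3\<close> rewritten; coprimality then removes the
      factor 3.\<close>
    moreover have "?N dvd 3 * (x\<^sup>2 + 1)"
      using t L by (simp add: add.commute)
    ultimately have "?N dvd x\<^sup>2 + 1"
      using coprime_dvd_mult_right_iff by blast
    then show False
      using odd_dvd_square_plus_one_mod_4 N by fastforce
  qed
  moreover from this have "x = 1"
    using L assms by (simp add: lucas_num_small)
  ultimately show "(n, x) = (2, 1)"
    by simp
qed (simp add: lucas_num_small)

end
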